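(* Let $N\ge 2$, $d>0$, and consider the one-dimensional homogeneous Gaussian mixture model with $N$ components, whose adjacent means differ by $d$ and whose components all have variance $\sigma^2$. Let $G_W(\theta;\sigma)\in\mathbb{R}^{(N-1)\times(N-1)}$ be its Wasserstein information matrix. Then for every fixed $\theta$ with $1>\theta_1>\cdots>\theta_{N-1}>0$ and all $1\le i,j\le N-1$, $$\lim_{\sigma\to 0}\frac{\big(G_W(\theta;\sigma)\big)_{ij}}{K(\sigma)}=\frac{\delta_{ij}}{\sqrt{p_i\,p_{i+1}}},\qquad K(\sigma)=\sqrt{2\pi^3}\,\frac{\sigma^3}{d}\,e^{\frac{d^2}{8\sigma^2}},$$ where $\delta_{ij}$ is the Kronecker symbol. In matrix form, $$G_{\widetilde W}(\theta)=\lim_{\sigma\to0}\frac{G_W(\theta;\sigma)}{K(\sigma)}=\mathrm{diag}\left(\frac{1}{\sqrt{p_1p_2}},\frac{1}{\sqrt{p_2p_3}},\dots,\frac{1}{\sqrt{p_{N-1}p_N}}\right).$$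
   Context: Homogeneous 1D Gaussian mixture model (GMM): fix means $\mu_1<\mu_2<\cdots<\mu_N$ with $\mu_{i}-\mu_{i-1}=d$ for $i=2,\dots,N$, and for $\sigma>0$ let $\rho_i(x)=\frac{1}{\sqrt{2\pi}\sigma}e^{-(x-\mu_i)^2/(2\sigma^2)}$, with cumulative distribution function $F_i(x)=\int_{-\infty}^x\rho_i(s)\,ds$. For parameters $\theta=(\theta_1,\dots,\theta_{N-1})$ with $1=\theta_0>\theta_1>\cdots>\theta_{N-1}>\theta_N=0$, the model is $$\rho_\theta=\sum_{i=1}^{N-1}\theta_i(\rho_{i+1}-\rho_i)+\rho_1=\sum_{i=1}^N p_i\rho_i,\qquad p_i=\theta_{i-1}-\theta_i>0 .$$ Only $\theta$ varies; the means are fixed. Wasserstein information matrix: the matrix of the pullback to the parameter space of the Wasserstein metric on densities on $\mathbb{R}$, namely $g_W(v_1,v_2)=\int_{\mathbb{R}}\frac{V_1(x)V_2(x)}{\rho(x)}dx$ with $V_k(x)=\int_{-\infty}^xv_k(s)ds$ for tangent vectors $v_1,v_2$ at $\rho$. For this model $$\big(G_W(\theta;\sigma)\big)_{ij}=\int_{\mathbb{R}}\frac{(F_{i+1}(x)-F_i(x))(F_{j+1}(x)-F_j(x))}{\rho_\theta(x)}\,dx .$$ *)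

theory Defs
  imports "HOL-Probability.Probability" "Jordan_Normal_Form.Matrix"
begin

definition wasserstein_metric :: "(real \<Rightarrow> real) \<Rightarrow> (real \<Rightarrow> real) \<Rightarrow> (real \<Rightarrow> real) \<Rightarrow> real" where
  "wasserstein_metric \<rho> v\<^sub>1 v\<^sub>2 =
     (LBINT x. (LBINT s:{..x}. v\<^sub>1 s) * (LBINT s:{..x}. v\<^sub>2 s) / \<rho> x)"

definition partial_deriv :: "nat \<Rightarrow> ((nat \<Rightarrow> real) \<Rightarrow> real) \<Rightarrow> (nat \<Rightarrow> real) \<Rightarrow> real" where
  "partial_deriv i f \<theta> = deriv (\<lambda>t. f (\<theta>(i := t))) (\<theta> i)"

text \<open>Parameters are numbered from 1 to \<open>n\<close>, whereas entries of type \<open>mat\<close> are indexed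
  from 0: the entry for the parameters \<open>i\<close>, \<open>j\<close> sits at \<open>(i - 1, j - 1)\<close>.\<close>

definition wasserstein_information_matrix ::
    "nat \<Rightarrow> ((nat \<Rightarrow> real) \<Rightarrow> real \<Rightarrow> real) \<Rightarrow> (nat \<Rightarrow> real) \<Rightarrow> real mat" where
  "wasserstein_information_matrix n \<rho> \<theta> = mat n n (\<lambda>(i, j).
     wasserstein_metric (\<rho> \<theta>)
       (\<lambda>x. partial_deriv (i + 1) (\<lambda>\<eta>. \<rho> \<eta> x) \<theta>)
       (\<lambda>x. partial_deriv (j + 1) (\<lambda>\<eta>. \<rho> \<eta> x) \<theta>))"

text \<open>The free parameters are \<open>\<theta> 1, \<dots>, \<theta> (N - 1)\<close>; the boundary values
  \<open>\<theta> 0 = 1\<close> and \<open>\<theta> N = 0\<close> enter only through the weights.\<close>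

definition gmm_density :: "nat \<Rightarrow> (nat \<Rightarrow> real) \<Rightarrow> real \<Rightarrow> (nat \<Rightarrow> real) \<Rightarrow> real \<Rightarrow> real" where
  "gmm_density N \<mu> \<sigma> \<theta> x =
     (\<Sum>i = 1..N - 1. \<theta> i * (normal_density (\<mu> (i + 1)) \<sigma> x - normal_density (\<mu> i) \<sigma> x))
       + normal_density (\<mu> 1) \<sigma> x"

definition gmm_weight :: "(nat \<Rightarrow> real) \<Rightarrow> nat \<Rightarrow> real" where
  "gmm_weight \<theta> i = \<theta> (i - 1) - \<theta> i"

definition gmm_wim :: "nat \<Rightarrow> (nat \<Rightarrow> real) \<Rightarrow> (nat \<Rightarrow> real) \<Rightarrow> real \<Rightarrow> real mat" where
  "gmm_wim N \<mu> \<theta> \<sigma> = wasserstein_information_matrix (N - 1) (gmm_density N \<mu> \<sigma>) \<theta>"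

definition scaling_factor :: "real \<Rightarrow> real \<Rightarrow> real" where
  "scaling_factor d \<sigma> = sqrt (2 * pi ^ 3) * (\<sigma> ^ 3 / d) * exp (d\<^sup>2 / (8 * \<sigma>\<^sup>2))"

text \<open>The type \<open>mat\<close> carries no topology; convergence in a fixed space of matrices is entrywise.\<close>

definition mat_tendsto :: "('a \<Rightarrow> real mat) \<Rightarrow> real mat \<Rightarrow> 'a filter \<Rightarrow> bool" where
  "mat_tendsto M L F \<longleftrightarrow>
     (\<forall>\<^sub>F x in F. M x \<in> carrier_mat (dim_row L) (dim_col L)) \<and>
     (\<forall>i < dim_row L. \<forall>j < dim_col L. ((\<lambda>x. M x $$ (i, j)) \<longlongrightarrow> L $$ (i, j)) F)"

lemma gmm_density_weights:
  assumes "N \<ge> 1" and "\<theta> 0 = 1" and "\<theta> N = 0"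
  shows "gmm_density N \<mu> \<sigma> \<theta> x = (\<Sum>i = 1..N. gmm_weight \<theta> i * normal_density (\<mu> i) \<sigma> x)"
proof -
  define r where "r i = normal_density (\<mu> i) \<sigma> x" for i
  have *: "(\<Sum>i = 1..Suc n. (\<theta> (i - 1) - \<theta> i) * r i) =
      (\<Sum>i = 1..n. \<theta> i * (r (i + 1) - r i)) + \<theta> 0 * r 1 - \<theta> (Suc n) * r (Suc n)" for n
    by (induction n) (simp_all add: algebra_simps)
  obtain n where "N = Suc n"
    using assms(1) by (cases N) auto
  then show ?thesis
    using *[of n] assms unfolding gmm_density_def gmm_weight_def r_def by simp
qed

lemma partial_deriv_gmm_density:
  assumes "i \<in> {1..N - 1}"
  shows "partial_deriv i (\<lambda>\<eta>. gmm_density N \<mu> \<sigma> \<eta> x) \<theta> =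
    normal_density (\<mu> (i + 1)) \<sigma> x - normal_density (\<mu> i) \<sigma> x"
proof -
  define D where "D k = normal_density (\<mu> (k + 1)) \<sigma> x - normal_density (\<mu> k) \<sigma> x" for k
  define C where "C = (\<Sum>k\<in>{1..N - 1} - {i}. \<theta> k * D k) + normal_density (\<mu> 1) \<sigma> x"
  have "gmm_density N \<mu> \<sigma> (\<theta>(i := t)) x = t * D i + C" for t
  proof -
    have "(\<Sum>k = 1..N - 1. (\<theta>(i := t)) k * D k) =
        t * D i + (\<Sum>k\<in>{1..N - 1} - {i}. (\<theta>(i := t)) k * D k)"
      using assms by (subst sum.remove[of _ i]) auto
    also have "(\<Sum>k\<in>{1..N - 1} - {i}. (\<theta>(i := t)) k * D k) =
        (\<Sum>k\<in>{1..N - 1} - {i}. \<theta> k * D k)"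
      by (rule sum.cong) auto
    finally show ?thesis
      unfolding gmm_density_def C_def D_def by simp
  qed
  moreover have "((\<lambda>t. t * D i + C) has_field_derivative D i) (at (\<theta> i))"
    by (auto intro!: derivative_eq_intros)
  ultimately show ?thesis
    unfolding partial_deriv_def by (simp add: DERIV_imp_deriv D_def)
qed

lemma gmm_wim_entry:
  fixes \<mu> :: "nat \<Rightarrow> real" and \<sigma> :: real
  defines "F \<equiv> \<lambda>i x. LBINT s:{..x}. normal_density (\<mu> i) \<sigma> s"
  assumes "\<sigma> > 0" and "i \<in> {1..N - 1}" and "j \<in> {1..N - 1}"
  shows "gmm_wim N \<mu> \<theta> \<sigma> $$ (i - 1, j - 1) =
    (LBINT x. (F (i + 1) x - F i x) * (F (j + 1) x - F j x) / gmm_density N \<mu> \<sigma> \<theta> x)"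
proof -
  have si: "set_integrable lborel {..x} (normal_density m \<sigma>)" for x m
    unfolding set_integrable_def
    by (rule integrable_mult_indicator) (use assms in auto)
  have "(LBINT s:{..x}. partial_deriv k (\<lambda>\<eta>. gmm_density N \<mu> \<sigma> \<eta> s) \<theta>) =
      F (k + 1) x - F k x" if "k \<in> {1..N - 1}" for k x
    unfolding partial_deriv_gmm_density[OF that] F_def
    by (rule set_integral_diff(2)[OF si si])
  from this[OF assms(3)] this[OF assms(4)] show ?thesis
    using assms(3,4)
    unfolding gmm_wim_def wasserstein_information_matrix_def wasserstein_metric_def by auto
qed

end

theory Submission
  imports Defs "HOL-Real_Asymp.Real_Asymp"
begin

text \<open>Substitute \<open>x = c + (\<sigma>\<^sup>2 / d) t\<close>, where \<open>c\<close> is the midpoint of \<open>\<mu> i\<close> and \<open>\<mu> (i + 1)\<close>.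
  After division by \<open>\<pi> (\<sigma>\<^sup>2 / d) \<surd>(2\<pi>\<sigma>\<^sup>2) exp (d\<^sup>2 / 8\<sigma>\<^sup>2)\<close>, which is the scaling factor, only the
  components \<open>i\<close> and \<open>i + 1\<close> survive in the density, and the integrand tends to
  \<open>\<delta>\<^sub>i\<^sub>j / (\<pi> (p\<^sub>i e\<^bsup>-t/2\<^esup> + p\<^sub>i\<^sub>+\<^sub>1 e\<^bsup>t/2\<^esup>))\<close>, whose integral is \<open>\<delta>\<^sub>i\<^sub>j / \<surd>(p\<^sub>i p\<^sub>i\<^sub>+\<^sub>1)\<close>.
  Gaussian tail bounds dominate the integrand by a multiple of \<open>exp (- \<bar>t\<bar> / 16)\<close>, uniformly in
  \<open>\<sigma>\<close>, so the limit passes under the integral.\<close>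

section \<open>Gaussian distribution functions: tail bounds and measurability\<close>

definition gauss_cdf :: "real \<Rightarrow> real \<Rightarrow> real \<Rightarrow> real" where
  "gauss_cdf m \<sigma> x = (LBINT s:{..x}. normal_density m \<sigma> s)"

lemma set_integrable_normal_density:
  assumes "\<sigma> > 0" "A \<in> sets borel"
  shows "set_integrable lborel A (normal_density m \<sigma>)"
  unfolding set_integrable_def
  by (rule integrable_mult_indicator) (use assms in auto)

text \<open>On such a set \<open>A\<close> the cross term in \<open>(s - m)\<^sup>2 = ((s - x) + (x - m))\<^sup>2\<close> is
  nonnegative, so the density at \<open>s\<close> is at most the prefactor times the density centred at \<open>x\<close>.\<close>
lemma normal_density_tail_le:
  assumes "\<sigma> > 0" "A \<in> sets borel" "\<And>s. s \<in> A \<Longrightarrow> (s - x) * (x - m) \<ge> 0"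
  shows "(LBINT s:A. normal_density m \<sigma> s) \<le> exp (- (x - m)\<^sup>2 / (2 * \<sigma>\<^sup>2))"
proof -
  let ?e = "exp (- (x - m)\<^sup>2 / (2 * \<sigma>\<^sup>2))"
  have le: "normal_density m \<sigma> s \<le> ?e * normal_density x \<sigma> s" if "s \<in> A" for s
  proof -
    have "(s - x)\<^sup>2 + (x - m)\<^sup>2 \<le> (s - m)\<^sup>2"
      using assms(3)[OF that] by (simp add: power2_eq_square algebra_simps)
    then have "- (s - m)\<^sup>2 / (2 * \<sigma>\<^sup>2) \<le> - (x - m)\<^sup>2 / (2 * \<sigma>\<^sup>2) + - (s - x)\<^sup>2 / (2 * \<sigma>\<^sup>2)"
      using assms(1) unfolding add_divide_distrib[symmetric] by (intro divide_right_mono) auto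
    then have "exp (- (s - m)\<^sup>2 / (2 * \<sigma>\<^sup>2)) \<le> ?e * exp (- (s - x)\<^sup>2 / (2 * \<sigma>\<^sup>2))"
      by (simp add: exp_add[symmetric])
    then have "1 / sqrt (2 * pi * \<sigma>\<^sup>2) * exp (- (s - m)\<^sup>2 / (2 * \<sigma>\<^sup>2))
        \<le> 1 / sqrt (2 * pi * \<sigma>\<^sup>2) * (?e * exp (- (s - x)\<^sup>2 / (2 * \<sigma>\<^sup>2)))"
      by (intro mult_left_mono) auto
    then show ?thesis
      unfolding normal_density_def by (simp add: mult_ac)
  qed
  \<comment> \<open>Enlarging \<open>A\<close> to the whole line costs nothing more than the total
    mass 1 of the density centred at \<open>x\<close>.\<close>
  have "(LBINT s:A. normal_density m \<sigma> s) \<le> (LBINT s. ?e * normal_density x \<sigma> s)"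
    unfolding set_lebesgue_integral_def
  proof (rule integral_mono)
    show "integrable lborel (\<lambda>s. indicator A s *\<^sub>R normal_density m \<sigma> s)"
      using set_integrable_normal_density[OF assms(1,2)] unfolding set_integrable_def .
    show "integrable lborel (\<lambda>s. ?e * normal_density x \<sigma> s)"
      using assms(1) by auto
    show "indicator A s *\<^sub>R normal_density m \<sigma> s \<le> ?e * normal_density x \<sigma> s" for s
      using le[of s] by (auto simp: indicator_def)
  qed
  also have "\<dots> = ?e"
    using assms(1) by simp
  finally show ?thesis .
qed

lemma gauss_cdf_compl:
  assumes "\<sigma> > 0"
  shows "1 - gauss_cdf m \<sigma> x = (LBINT s:{x<..}. normal_density m \<sigma> s)"
proof -
  have "(LBINT s:{..x} \<union> {x<..}. normal_density m \<sigma> s) =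
      gauss_cdf m \<sigma> x + (LBINT s:{x<..}. normal_density m \<sigma> s)"
    unfolding gauss_cdf_def
    by (rule set_integral_Un) (use assms in \<open>auto intro: set_integrable_normal_density\<close>)
  moreover have "{..x} \<union> {x<..} = UNIV"
    by auto
  ultimately show ?thesis
    using assms by (simp add: set_lebesgue_integral_def)
qed

lemma gauss_cdf_nonneg: "gauss_cdf m \<sigma> x \<ge> 0"
  unfolding gauss_cdf_def set_lebesgue_integral_def
  by (intro integral_nonneg_AE) auto

lemma gauss_cdf_le_1:
  assumes "\<sigma> > 0"
  shows "gauss_cdf m \<sigma> x \<le> 1"
proof -
  have "(LBINT s:{x<..}. normal_density m \<sigma> s) \<ge> 0"
    unfolding set_lebesgue_integral_def by (intro integral_nonneg_AE) auto
  then show ?thesis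
    using gauss_cdf_compl[OF assms, of m x] by linarith
qed

text \<open>For \<open>s \<le> x \<le> m\<close> both factors in the sign condition of
  \<open>normal_density_tail_le\<close> are nonpositive; for the upper tail both are
  nonnegative.\<close>

lemma gauss_cdf_lower_tail:
  assumes "\<sigma> > 0" "x \<le> m"
  shows "gauss_cdf m \<sigma> x \<le> exp (- (x - m)\<^sup>2 / (2 * \<sigma>\<^sup>2))"
  unfolding gauss_cdf_def
  by (rule normal_density_tail_le) (use assms in \<open>auto intro: mult_nonpos_nonpos\<close>)

lemma gauss_cdf_upper_tail:
  assumes "\<sigma> > 0" "x \<ge> m"
  shows "1 - gauss_cdf m \<sigma> x \<le> exp (- (x - m)\<^sup>2 / (2 * \<sigma>\<^sup>2))"
  unfolding gauss_cdf_compl[OF assms(1)]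
  by (rule normal_density_tail_le) (use assms in auto)

text \<open>Serves measurability: a monotone real function is Borel.\<close>

lemma mono_gauss_cdf:
  assumes "\<sigma> > 0"
  shows "mono (gauss_cdf m \<sigma>)"
proof (rule monoI)
  fix x y :: real assume "x \<le> y"
  show "gauss_cdf m \<sigma> x \<le> gauss_cdf m \<sigma> y"
    unfolding gauss_cdf_def set_lebesgue_integral_def
  proof (rule integral_mono)
    show "integrable lborel (\<lambda>s. indicator {..z} s *\<^sub>R normal_density m \<sigma> s)" for z
      using set_integrable_normal_density[OF assms, of "{..z}"] unfolding set_integrable_def by simp
    then show "integrable lborel (\<lambda>s. indicator {..y} s *\<^sub>R normal_density m \<sigma> s)" .
  qed (use \<open>x \<le> y\<close> in \<open>auto simp: indicator_def\<close>)
qed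

text \<open>For \<open>\<sigma> = 0\<close> the density is \<open>1 / 0 = 0\<close>.\<close>
lemma borel_measurable_gauss_cdf [measurable]: "gauss_cdf m \<sigma> \<in> borel_measurable borel"
proof (cases "\<sigma> = 0")
  case True
  then have "gauss_cdf m \<sigma> = (\<lambda>_. 0)"
    by (simp add: gauss_cdf_def normal_density_def set_lebesgue_integral_def fun_eq_iff)
  then show ?thesis
    by simp
next
  case False
  \<comment> \<open>The density depends on \<sigma> only through its square, so negative \<sigma>
    reduces to the monotone case.\<close>
  have "gauss_cdf m \<sigma> = gauss_cdf m \<bar>\<sigma>\<bar>"
    by (simp add: gauss_cdf_def normal_density_def fun_eq_iff)
  with False show ?thesis
    using borel_measurable_mono[OF mono_gauss_cdf[of "\<bar>\<sigma>\<bar>" m]] by simp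
qed

section \<open>Distribution functions as the variance vanishes\<close>

text \<open>The numerator tends to \<open>a^2 > 0\<close> and the denominator to 0 from above. The
  drift \<open>b * \<sigma>\<^sup>2\<close> is there because the substitution moves the evaluation
  point by that order.\<close>

lemma gauss_tail_tendsto_0:
  fixes a b :: real
  assumes "a \<noteq> 0"
  shows "((\<lambda>\<sigma>. exp (- (a + b * \<sigma>\<^sup>2)\<^sup>2 / (2 * \<sigma>\<^sup>2))) \<longlongrightarrow> 0) (at_right 0)"
proof -
  have "filterlim (\<lambda>\<sigma>. (a + b * \<sigma>\<^sup>2)\<^sup>2 / (2 * \<sigma>\<^sup>2)) at_top (at_right 0)"
  proof (rule LIM_at_top_divide)
    show "((\<lambda>\<sigma>. (a + b * \<sigma>\<^sup>2)\<^sup>2) \<longlongrightarrow> (a + b * 0\<^sup>2)\<^sup>2) (at_right 0)"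
      by (intro tendsto_intros)
    show "0 < (a + b * 0\<^sup>2)\<^sup>2"
      using assms by simp
    show "((\<lambda>\<sigma>. 2 * \<sigma>\<^sup>2) \<longlongrightarrow> (0::real)) (at_right 0)"
      by (auto intro!: tendsto_eq_intros)
    show "\<forall>\<^sub>F \<sigma>::real in at_right 0. 0 < 2 * \<sigma>\<^sup>2"
      by (auto simp: eventually_at_filter)
  qed
  then show ?thesis
    by (intro filterlim_compose[OF exp_at_bot]) (simp add: filterlim_uminus_at_bot)
qed

text \<open>For small \<sigma> the drift does not change the sign of the offset \<open>a\<close>, so
  the point stays on one side of the mean; the tail bound of that side and the bounds 0 and 1
  squeeze the value.\<close>

lemma gauss_cdf_tendsto:
  fixes a b m :: real
  assumes "a \<noteq> 0"
  shows "((\<lambda>\<sigma>. gauss_cdf m \<sigma> (m + a + b * \<sigma>\<^sup>2)) \<longlongrightarrow> (if a > 0 then 1 else 0)) (at_right 0)"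
proof -
  have lim: "((\<lambda>\<sigma>. a + b * \<sigma>\<^sup>2) \<longlongrightarrow> a) (at_right 0)"
    by (auto intro!: tendsto_eq_intros)
  have pos: "\<forall>\<^sub>F \<sigma>::real in at_right 0. \<sigma> > 0"
    by (simp add: eventually_at_filter)
  show ?thesis
  proof (cases "a > 0")
    case True
    have ev: "\<forall>\<^sub>F \<sigma> in at_right 0. 1 - exp (- (a + b * \<sigma>\<^sup>2)\<^sup>2 / (2 * \<sigma>\<^sup>2)) \<le>
        gauss_cdf m \<sigma> (m + a + b * \<sigma>\<^sup>2) \<and> gauss_cdf m \<sigma> (m + a + b * \<sigma>\<^sup>2) \<le> 1"
      using order_tendstoD(1)[OF lim True] pos
    proof eventually_elim
      case (elim \<sigma>)
      then show ?case
        using gauss_cdf_upper_tail[of \<sigma> m "m + a + b * \<sigma>\<^sup>2"]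
          gauss_cdf_le_1[of \<sigma> m "m + a + b * \<sigma>\<^sup>2"] by (simp add: add.assoc)
    qed
    have "((\<lambda>\<sigma>. 1 - exp (- (a + b * \<sigma>\<^sup>2)\<^sup>2 / (2 * \<sigma>\<^sup>2))) \<longlongrightarrow> 1) (at_right 0)"
      using tendsto_diff[OF tendsto_const gauss_tail_tendsto_0[OF assms, of b]] by simp
    then have "((\<lambda>\<sigma>. gauss_cdf m \<sigma> (m + a + b * \<sigma>\<^sup>2)) \<longlongrightarrow> 1) (at_right 0)"
      by (rule tendsto_sandwich[OF _ _ _ tendsto_const, rotated 2])
        (use ev in \<open>auto elim: eventually_mono\<close>)
    with True show ?thesis
      by simp
  next
    case False
    with assms have "a < 0" by simp
    have ev: "\<forall>\<^sub>F \<sigma> in at_right 0. 0 \<le> gauss_cdf m \<sigma> (m + a + b * \<sigma>\<^sup>2) \<and>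
        gauss_cdf m \<sigma> (m + a + b * \<sigma>\<^sup>2) \<le> exp (- (a + b * \<sigma>\<^sup>2)\<^sup>2 / (2 * \<sigma>\<^sup>2))"
      using order_tendstoD(2)[OF lim \<open>a < 0\<close>] pos
    proof eventually_elim
      case (elim \<sigma>)
      then show ?case
        using gauss_cdf_lower_tail[of \<sigma> "m + a + b * \<sigma>\<^sup>2" m]
          gauss_cdf_nonneg[of m \<sigma> "m + a + b * \<sigma>\<^sup>2"] by (simp add: add.assoc)
    qed
    have "((\<lambda>\<sigma>. gauss_cdf m \<sigma> (m + a + b * \<sigma>\<^sup>2)) \<longlongrightarrow> 0) (at_right 0)"
      by (rule tendsto_sandwich[OF _ _ tendsto_const gauss_tail_tendsto_0[OF assms, of b]])
        (use ev in \<open>auto elim: eventually_mono\<close>)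
    with False show ?thesis
      by simp
  qed
qed

section \<open>The limiting integral and an integrable majorant\<close>

text \<open>With \<open>e = exp (t / 2)\<close> the integrand is
  \<open>e / (p + q * e\<^sup>2)\<close>, which has an arctangent as antiderivative, running from 0
  to \<open>pi / sqrt (p * q)\<close>.\<close>

lemma integral_inverse_exp_sum:
  fixes p q :: real
  assumes "p > 0" "q > 0"
  defines "f \<equiv> \<lambda>t. 1 / (p * exp (- t / 2) + q * exp (t / 2))"
  shows "integrable lborel f" and "(LBINT t. f t) = pi / sqrt (p * q)"
proof -
  define r where "r = sqrt (q / p)"
  define F where "F t = 2 / sqrt (p * q) * arctan (r * exp (t / 2))" for t
  have r: "r > 0" "r\<^sup>2 = q / p" "r / sqrt (p * q) = 1 / p"
    using assms by (auto simp: r_def real_sqrt_divide real_sqrt_mult field_simps)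
  have den: "p * exp (- t / 2) + q * exp (t / 2) > 0" for t
    using assms by (intro add_pos_pos) auto
  have deriv: "(F has_real_derivative f t) (at t)" for t
  proof -
    define e where "e = exp (t / 2)"
    have e: "e > 0" "exp (- t / 2) = 1 / e"
      by (auto simp: e_def exp_minus field_simps)
    have "((\<lambda>t. r * exp (t / 2)) has_real_derivative r * (exp (t / 2) * (1 / 2))) (at t)"
      by (auto intro!: derivative_eq_intros)
    from DERIV_cmult[OF DERIV_chain2[OF DERIV_arctan this], of "2 / sqrt (p * q)"]
    have "(F has_real_derivative 2 / sqrt (p * q) *
        (inverse (1 + (r * e)\<^sup>2) * (r * (e * (1 / 2))))) (at t)"
      unfolding F_def e_def .
    moreover have "2 / s * (inverse c * (r * (e * (1 / 2)))) = (r / s) * (e / c)" for s c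
      by (simp add: field_simps)
    moreover have "(r * e)\<^sup>2 = q / p * e\<^sup>2"
      by (simp add: power_mult_distrib r(2))
    moreover have "(1 / p) * (e / (1 + q / p * e\<^sup>2)) = f t"
    proof -
      have "p + q * e\<^sup>2 > 0"
        using assms e by (intro add_pos_nonneg) auto
      then show ?thesis
        unfolding f_def e(2) e_def[symmetric] using assms e(1)
        by (simp add: field_simps power2_eq_square)
    qed
    ultimately show ?thesis
      by (simp only: r(3))
  qed
  have cont: "isCont f t" for t
    unfolding f_def using den[of t] by (intro continuous_intros) auto
  have "((\<lambda>t. arctan (r * exp (t / 2))) \<longlongrightarrow> arctan (r * 0)) at_bot"
    by (intro tendsto_intros filterlim_compose[OF exp_at_bot]) real_asymp
  then have "(F \<longlongrightarrow> 2 / sqrt (p * q) * arctan (r * 0)) at_bot"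
    unfolding F_def by (rule tendsto_mult_left)
  then have bot: "(F \<longlongrightarrow> 0) at_bot"
    by simp
  have "filterlim (\<lambda>t. r * exp (t / 2)) at_top at_top"
    using r(1) by real_asymp
  then have top: "(F \<longlongrightarrow> 2 / sqrt (p * q) * (pi / 2)) at_top"
    unfolding F_def by (intro tendsto_intros filterlim_compose[OF tendsto_arctan_at_top])
  \<comment> \<open>Since the integrand is nonnegative, the fundamental theorem on the whole line
    yields integrability along with the value.\<close>
  have *: "set_integrable lborel (einterval (-\<infinity>) \<infinity>) f"
    "(LBINT t=-\<infinity>..\<infinity>. f t) = 2 / sqrt (p * q) * (pi / 2) - 0"
  proof (rule_tac [!] interval_integral_FTC_nonneg[where F = F])
    show "AE t in lborel. - \<infinity> < ereal t \<longrightarrow> ereal t < \<infinity> \<longrightarrow> 0 \<le> f t"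
      using den by (auto simp: f_def less_imp_le)
    then show "AE t in lborel. - \<infinity> < ereal t \<longrightarrow> ereal t < \<infinity> \<longrightarrow> 0 \<le> f t" .
  qed (use deriv cont bot top in
      \<open>simp_all add: ereal_tendsto_simps\<close>)
  show "integrable lborel f"
    using *(1) by (simp add: set_integrable_def)
  show "(LBINT t. f t) = pi / sqrt (p * q)"
    using *(2) by (simp add: interval_lebesgue_integral_def set_lebesgue_integral_def)
qed

text \<open>Turns the exponential bound into a function of the form just integrated, so that the
  majorant inherits its integrability.\<close>

lemma exp_neg_abs_le_inverse_exp_sum:
  fixes t :: real
  shows "exp (- \<bar>t\<bar>) \<le> 2 / (exp (- t) + exp t)"
proof -
  have "exp (- \<bar>t\<bar>) * (exp (- t) + exp t) = exp (- \<bar>t\<bar> - t) + exp (- \<bar>t\<bar> + t)"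
    by (simp add: distrib_left mult_exp_exp)
  also have "\<dots> \<le> 1 + 1"
    by (intro add_mono) auto
  finally show ?thesis
    by (simp add: pos_le_divide_eq add_pos_pos)
qed

section \<open>The mixture: weights, means and density\<close>

locale gaussian_mixture =
  fixes N :: nat and d :: real and \<mu> \<theta> :: "nat \<Rightarrow> real"
  assumes d_pos: "d > 0"
    and spacing: "\<And>i. i \<in> {2..N} \<Longrightarrow> \<mu> i - \<mu> (i - 1) = d"
    and theta_0: "\<theta> 0 = 1" and theta_N: "\<theta> N = 0"
    and theta_decreasing: "\<And>i. i \<in> {1..N} \<Longrightarrow> \<theta> (i - 1) > \<theta> i"
begin

abbreviation "p \<equiv> gmm_weight \<theta>"
abbreviation "\<rho> \<equiv> \<lambda>\<sigma>. gmm_density N \<mu> \<sigma> \<theta>"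

definition "mid i = (\<mu> i + \<mu> (i + 1)) / 2"
text \<open>The primitive of the tangent vector of the \<open>i\<close>-th parameter, that is, a
  factor of the numerator in \<open>gmm_wim_entry\<close>.\<close>

definition "D i \<sigma> x = gauss_cdf (\<mu> (i + 1)) \<sigma> x - gauss_cdf (\<mu> i) \<sigma> x"

lemma weight_pos: "k \<in> {1..N} \<Longrightarrow> p k > 0"
  using theta_decreasing by (simp add: gmm_weight_def)

lemma index_range:
  assumes "i \<in> {1..N - 1}"
  shows "N \<ge> 1" "i \<in> {1..N}" "i + 1 \<in> {1..N}"
  using assms by auto

lemma mean_diff:
  assumes "i \<in> {1..N}" "k \<in> {1..N}"
  shows "\<mu> i - \<mu> k = (real i - real k) * d"
proof -
  have "\<mu> (Suc n) = \<mu> 1 + real n * d" if "Suc n \<le> N" for n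
    using that
  proof (induction n)
    case (Suc n)
    then show ?case using spacing[of "Suc (Suc n)"] by (simp add: algebra_simps)
  qed simp
  from this[of "i - 1"] this[of "k - 1"] show ?thesis
    using assms by (simp add: of_nat_diff algebra_simps)
qed

lemma mid_diff:
  assumes "i \<in> {1..N - 1}" "k \<in> {1..N}"
  shows "mid i - \<mu> k = (real i - real k + 1 / 2) * d"
  using mean_diff[OF index_range(2)[OF assms(1)] assms(2)]
    mean_diff[OF index_range(3)[OF assms(1)] assms(2)] by (simp add: mid_def field_simps)

lemma density_eq:
  assumes "N \<ge> 1"
  shows "\<rho> \<sigma> x = (\<Sum>k = 1..N. p k * normal_density (\<mu> k) \<sigma> x)"
  by (rule gmm_density_weights[OF assms theta_0 theta_N])

lemma density_ge:
  assumes "k \<in> {1..N}"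
  shows "\<rho> \<sigma> x \<ge> p k * normal_density (\<mu> k) \<sigma> x"
proof -
  have "p k * normal_density (\<mu> k) \<sigma> x \<le> (\<Sum>k = 1..N. p k * normal_density (\<mu> k) \<sigma> x)"
    by (rule member_le_sum) (use assms weight_pos in \<open>auto intro!: mult_nonneg_nonneg intro: less_imp_le\<close>)
  then show ?thesis
    using density_eq assms by simp
qed

lemma density_pos:
  assumes "N \<ge> 1" "\<sigma> > 0"
  shows "\<rho> \<sigma> x > 0"
proof -
  have "0 < p 1 * normal_density (\<mu> 1) \<sigma> x"
    using weight_pos[of 1] assms by (simp add: normal_density_pos)
  also have "\<dots> \<le> \<rho> \<sigma> x"
    using density_ge[of 1] assms by simp
  finally show ?thesis .
qed

section \<open>Pointwise limits after rescaling around a midpoint\<close>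

text \<open>The point stays near \<open>mid i\<close>, where the distribution functions of
  components up to \<open>i\<close> tend to 1 and the later ones to 0. Two adjacent ones differ in
  the limit only across this gap, and there the right one is the smaller.\<close>

lemma D_tendsto:
  assumes "i \<in> {1..N - 1}" "j \<in> {1..N - 1}"
  shows "((\<lambda>\<sigma>. D j \<sigma> (mid i + \<sigma>\<^sup>2 / d * t)) \<longlongrightarrow> (if i = j then - 1 else 0)) (at_right 0)"
proof -
  have "((\<lambda>\<sigma>. gauss_cdf (\<mu> k) \<sigma> (mid i + \<sigma>\<^sup>2 / d * t)) \<longlongrightarrow> (if k \<le> i then 1 else 0)) (at_right 0)"
    if "k \<in> {1..N}" for k
  proof -
    \<comment> \<open>Half of an odd integer: the midpoint never hits a mean.\<close>
    have "real i - real k + 1 / 2 = of_int (2 * int i - 2 * int k + 1) / 2"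
      by simp
    moreover have "2 * int i - 2 * int k + 1 \<noteq> 0"
      by presburger
    ultimately have "real i - real k + 1 / 2 \<noteq> 0"
      by (metis divide_eq_0_iff of_int_eq_0_iff zero_neq_numeral)
    with mid_diff[OF assms(1) that] d_pos have "mid i - \<mu> k \<noteq> 0"
      by simp
    moreover have "mid i - \<mu> k > 0 \<longleftrightarrow> k \<le> i"
      unfolding mid_diff[OF assms(1) that] using d_pos by (auto simp: zero_less_mult_iff)
    ultimately show ?thesis
      using gauss_cdf_tendsto[of "mid i - \<mu> k" "\<mu> k" "t / d"] by (simp add: mult_ac)
  qed
  note lim = tendsto_diff[OF this[OF index_range(3)[OF assms(2)]] this[OF index_range(2)[OF assms(2)]]]
  have "(if j + 1 \<le> i then 1 else 0) - (if j \<le> i then 1 else 0) = (if i = j then - 1 else 0 :: real)"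
    by auto
  with lim show ?thesis
    unfolding D_def by simp
qed

text \<open>Expanding the square in each exponent and removing the common
  \<open>d^2 / (8 \<sigma>^2)\<close> leaves \<open>A k / (2 \<sigma>^2)\<close>, a term linear in
  \<open>t\<close> and a vanishing rest. The two components next to the midpoint have
  \<open>A k = 0\<close>; all others have \<open>A k > 0\<close> and die out.\<close>

lemma density_tendsto:
  assumes i: "i \<in> {1..N - 1}"
  shows "((\<lambda>\<sigma>. sqrt (2 * pi * \<sigma>\<^sup>2) * exp (d\<^sup>2 / (8 * \<sigma>\<^sup>2)) * \<rho> \<sigma> (mid i + \<sigma>\<^sup>2 / d * t))
           \<longlongrightarrow> p i * exp (- t / 2) + p (i + 1) * exp (t / 2)) (at_right 0)"
proof -
  define b where "b k = real i - real k + 1 / 2" for k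
  \<comment> \<open>The excess of the squared distance from \<open>mid i\<close> to the
    \<open>k\<close>-th mean over its minimum \<open>d^2 / 4\<close>.\<close>
  define A where "A k = d\<^sup>2 * (b k ^ 2 - 1 / 4)" for k
  have A: "A k = d\<^sup>2 * ((real i - real k) * (real i - real k + 1))" for k
    by (simp add: A_def b_def power2_eq_square algebra_simps)
  let ?E = "\<lambda>k \<sigma>. exp (- (A k / (2 * \<sigma>\<^sup>2)) - b k * t - t\<^sup>2 / (2 * d\<^sup>2) * \<sigma>\<^sup>2)"
  let ?L = "\<lambda>k. if k = i \<or> k = i + 1 then exp (- (b k * t)) else 0"
  have lim: "((\<lambda>\<sigma>. p k * ?E k \<sigma>) \<longlongrightarrow> p k * ?L k) (at_right 0)" for k
  proof (rule tendsto_mult_left)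
    show "(?E k \<longlongrightarrow> ?L k) (at_right 0)"
    proof (cases "k = i \<or> k = i + 1")
      case True
      then have "A k = 0"
        by (auto simp: A)
      moreover have "((\<lambda>\<sigma>. exp (- (b k * t) - t\<^sup>2 / (2 * d\<^sup>2) * \<sigma>\<^sup>2)) \<longlongrightarrow>
          exp (- (b k * t) - t\<^sup>2 / (2 * d\<^sup>2) * 0\<^sup>2)) (at_right 0)"
        by (intro tendsto_intros)
      ultimately show ?thesis
        using True by simp
    next
      case False
      then have "k < i \<or> k > i + 1"
        by auto
      then have "(real i - real k) * (real i - real k + 1) > 0"
        by (auto intro: mult_pos_pos mult_neg_neg)
      with d_pos have "A k > 0"
        by (simp add: A)
      moreover have "((\<lambda>\<sigma>. exp (- (a / (2 * \<sigma>\<^sup>2)) - B - C * \<sigma>\<^sup>2)) \<longlongrightarrow> 0) (at_right 0)"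
        if "a > 0" for a B C :: real
        using that by real_asymp
      ultimately show ?thesis
        using False by presburger
    qed
  qed
  have "((\<lambda>\<sigma>. \<Sum>k = 1..N. p k * ?E k \<sigma>) \<longlongrightarrow> (\<Sum>k = 1..N. p k * ?L k)) (at_right 0)"
    by (intro tendsto_sum lim)
  also have "(\<Sum>k = 1..N. p k * ?L k) = (\<Sum>k\<in>{i, i + 1}. p k * ?L k)"
    by (rule sum.mono_neutral_right) (use i in auto)
  also have "\<dots> = p i * exp (- t / 2) + p (i + 1) * exp (t / 2)"
    by (simp add: b_def)
  finally have "((\<lambda>\<sigma>. \<Sum>k = 1..N. p k * ?E k \<sigma>) \<longlongrightarrow> \<dots>) (at_right 0)" .
  moreover have "\<forall>\<^sub>F \<sigma> in at_right 0. (\<Sum>k = 1..N. p k * ?E k \<sigma>) =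
      sqrt (2 * pi * \<sigma>\<^sup>2) * exp (d\<^sup>2 / (8 * \<sigma>\<^sup>2)) * \<rho> \<sigma> (mid i + \<sigma>\<^sup>2 / d * t)"
    using eventually_at_right_less[of 0]
  proof eventually_elim
    case (elim \<sigma>)
    have "p k * ?E k \<sigma> = sqrt (2 * pi * \<sigma>\<^sup>2) * exp (d\<^sup>2 / (8 * \<sigma>\<^sup>2)) *
        (p k * normal_density (\<mu> k) \<sigma> (mid i + \<sigma>\<^sup>2 / d * t))" if "k \<in> {1..N}" for k
    proof -
      let ?x = "mid i + \<sigma>\<^sup>2 / d * t"
      have "?x - \<mu> k = b k * d + \<sigma>\<^sup>2 / d * t"
        using mid_diff[OF i that] by (simp add: b_def)
      then have "- (A k / (2 * \<sigma>\<^sup>2)) - b k * t - t\<^sup>2 / (2 * d\<^sup>2) * \<sigma>\<^sup>2 =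
          d\<^sup>2 / (8 * \<sigma>\<^sup>2) + - (?x - \<mu> k)\<^sup>2 / (2 * \<sigma>\<^sup>2)"
        using elim d_pos by (simp add: A_def field_simps power2_eq_square)
      then have "?E k \<sigma> = exp (d\<^sup>2 / (8 * \<sigma>\<^sup>2)) * exp (- (?x - \<mu> k)\<^sup>2 / (2 * \<sigma>\<^sup>2))"
        by (simp only: exp_add)
      then show ?thesis
        using elim by (simp add: normal_density_def)
    qed
    then show ?case
      unfolding density_eq[OF index_range(1)[OF i]] sum_distrib_left by (rule sum.cong[OF refl])
  qed
  ultimately show ?thesis
    by (rule Lim_transform_eventually)
qed

section \<open>Uniform domination of the integrand\<close>

text \<open>Inside \<open>[\<mu> i, \<mu> (i + 1)]\<close> only the density decays; outside, the squared Gaussian tail of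
  \<open>D i\<close> beats it. The rate \<open>1/8\<close> is small enough for both exponents.\<close>
lemma D_square_le:
  assumes "i \<in> {1..N - 1}" "\<sigma> > 0" "m > 0" "m \<le> p i" "m \<le> p (i + 1)"
  shows "m * (D i \<sigma> x)\<^sup>2 \<le>
    sqrt (2 * pi * \<sigma>\<^sup>2) * \<rho> \<sigma> x * exp (d\<^sup>2 / (8 * \<sigma>\<^sup>2) - \<bar>x - mid i\<bar> * d / (8 * \<sigma>\<^sup>2))"
proof -
  define u where "u = \<bar>x - mid i\<bar>"
  \<comment> \<open>Up to its normalising constant, the density at \<open>x\<close> of whichever of
    the components \<open>i\<close>, \<open>i + 1\<close> has its mean nearer to
    \<open>x\<close>.\<close>
  define g where "g = exp (- (u - d / 2)\<^sup>2 / (2 * \<sigma>\<^sup>2))"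
  have mu: "\<mu> i = mid i - d / 2" "\<mu> (i + 1) = mid i + d / 2"
    using mid_diff[OF assms(1) index_range(2)[OF assms(1)]]
      mid_diff[OF assms(1) index_range(3)[OF assms(1)]] by auto
  have rho: "m * g \<le> sqrt (2 * pi * \<sigma>\<^sup>2) * \<rho> \<sigma> x"
  proof -
    have *: "m * g \<le> sqrt (2 * pi * \<sigma>\<^sup>2) * \<rho> \<sigma> x"
      if "k \<in> {1..N}" "m \<le> p k" "(x - \<mu> k)\<^sup>2 = (u - d / 2)\<^sup>2" for k
    proof -
      have "m * g \<le> p k * g"
        using that(2) by (intro mult_right_mono) (auto simp: g_def)
      also have "\<dots> = sqrt (2 * pi * \<sigma>\<^sup>2) * (p k * normal_density (\<mu> k) \<sigma> x)"
        using assms(2) that(3) by (simp add: g_def normal_density_def)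
      also have "\<dots> \<le> sqrt (2 * pi * \<sigma>\<^sup>2) * \<rho> \<sigma> x"
        by (intro mult_left_mono density_ge that) simp
      finally show ?thesis .
    qed
    show ?thesis
    proof (cases "x \<ge> mid i")
      case True
      then show ?thesis
        using *[of "i + 1"] assms mu by (auto simp: u_def diff_diff_eq)
    next
      case False
      then have "(x - \<mu> i)\<^sup>2 = (u - d / 2)\<^sup>2"
        unfolding mu u_def by (simp add: power2_eq_square algebra_simps)
      then show ?thesis
        using *[of i] assms by auto
    qed
  qed
  have D1: "\<bar>D i \<sigma> x\<bar> \<le> 1"
    unfolding D_def
    using gauss_cdf_nonneg[of "\<mu> i" \<sigma> x] gauss_cdf_nonneg[of "\<mu> (i + 1)" \<sigma> x]
      gauss_cdf_le_1[OF assms(2), of "\<mu> i" x] gauss_cdf_le_1[OF assms(2), of "\<mu> (i + 1)" x] by linarith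
  \<comment> \<open>Outside the two means, both distribution functions, or both their complements,
    lie in \<open>[0, g]\<close>, hence so does the absolute value of their difference.\<close>
  have Dg: "\<bar>D i \<sigma> x\<bar> \<le> g" if u: "u \<ge> d / 2"
  proof -
    consider "x \<le> \<mu> i" "u = mid i - x" | "x \<ge> \<mu> (i + 1)" "u = x - mid i"
      using u d_pos unfolding mu u_def by (cases "x \<ge> mid i") auto
    then show ?thesis
    proof cases
      case 1
      have "(x - \<mu> i)\<^sup>2 = (u - d / 2)\<^sup>2"
        unfolding 1(2) mu by (simp add: power2_eq_square algebra_simps)
      then have "gauss_cdf (\<mu> i) \<sigma> x \<le> g"
        using gauss_cdf_lower_tail[OF assms(2) 1(1)] by (simp add: g_def)
      moreover have "(u - d / 2)\<^sup>2 \<le> (x - \<mu> (i + 1))\<^sup>2"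
        unfolding abs_le_square_iff[symmetric] using 1 d_pos unfolding mu by linarith
      then have "exp (- (x - \<mu> (i + 1))\<^sup>2 / (2 * \<sigma>\<^sup>2)) \<le> g"
        using assms(2) unfolding g_def by (simp add: divide_right_mono)
      moreover have "gauss_cdf (\<mu> (i + 1)) \<sigma> x \<le> exp (- (x - \<mu> (i + 1))\<^sup>2 / (2 * \<sigma>\<^sup>2))"
        by (rule gauss_cdf_lower_tail) (use assms 1 mu d_pos in auto)
      ultimately show ?thesis
        using gauss_cdf_nonneg[of "\<mu> i" \<sigma> x] gauss_cdf_nonneg[of "\<mu> (i + 1)" \<sigma> x]
        unfolding D_def by linarith
    next
      case 2
      have "(x - \<mu> (i + 1))\<^sup>2 = (u - d / 2)\<^sup>2"
        unfolding 2(2) mu by (simp add: power2_eq_square algebra_simps)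
      then have "1 - gauss_cdf (\<mu> (i + 1)) \<sigma> x \<le> g"
        using gauss_cdf_upper_tail[OF assms(2) 2(1)] by (simp add: g_def)
      moreover have "(u - d / 2)\<^sup>2 \<le> (x - \<mu> i)\<^sup>2"
        unfolding abs_le_square_iff[symmetric] using 2 d_pos unfolding mu by linarith
      then have "exp (- (x - \<mu> i)\<^sup>2 / (2 * \<sigma>\<^sup>2)) \<le> g"
        using assms(2) unfolding g_def by (simp add: divide_right_mono)
      moreover have "1 - gauss_cdf (\<mu> i) \<sigma> x \<le> exp (- (x - \<mu> i)\<^sup>2 / (2 * \<sigma>\<^sup>2))"
        by (rule gauss_cdf_upper_tail) (use assms 2 mu d_pos in auto)
      ultimately show ?thesis
        using gauss_cdf_le_1[OF assms(2), of "\<mu> i" x] gauss_cdf_le_1[OF assms(2), of "\<mu> (i + 1)" x]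
        unfolding D_def by linarith
    qed
  qed
  have "(D i \<sigma> x)\<^sup>2 \<le> g * exp (d\<^sup>2 / (8 * \<sigma>\<^sup>2) - u * d / (8 * \<sigma>\<^sup>2))"
  proof (cases "u \<ge> d / 2")
    case True
    have "(D i \<sigma> x)\<^sup>2 \<le> g * g"
      using power_mono[OF Dg[OF True], of 2] by (simp add: power2_eq_square)
    moreover have "g \<le> exp (d\<^sup>2 / (8 * \<sigma>\<^sup>2) - u * d / (8 * \<sigma>\<^sup>2))"
    proof -
      \<comment> \<open>Completing the square in
        \<open>4 * (u - d / 2)\<^sup>2 + d\<^sup>2 - u * d\<close>, which is 4 times the right-hand
        side.\<close>
      have "0 \<le> (u - 5 / 8 * d)\<^sup>2 + 7 / 64 * d\<^sup>2"
        by simp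
      then have "- 4 * (u - d / 2)\<^sup>2 \<le> d\<^sup>2 - u * d"
        by (simp add: power2_eq_square algebra_simps)
      then have "- 4 * (u - d / 2)\<^sup>2 / (8 * \<sigma>\<^sup>2) \<le> (d\<^sup>2 - u * d) / (8 * \<sigma>\<^sup>2)"
        by (intro divide_right_mono) auto
      then show ?thesis
        unfolding g_def by (simp add: diff_divide_distrib)
    qed
    ultimately show ?thesis
      by (auto intro: order_trans mult_left_mono simp: g_def)
  next
    case False
    have "(D i \<sigma> x)\<^sup>2 \<le> 1"
      using D1 by (simp add: abs_square_le_1)
    also have "1 \<le> exp (- (u - d / 2)\<^sup>2 / (2 * \<sigma>\<^sup>2) + (d\<^sup>2 / (8 * \<sigma>\<^sup>2) - u * d / (8 * \<sigma>\<^sup>2)))"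
    proof -
      \<comment> \<open>The combined exponent over the denominator
        \<open>8 * \<sigma>\<^sup>2\<close> has numerator
        \<open>4 * u * (3 / 4 * d - u)\<close>.\<close>
      have "0 \<le> u * (3 / 4 * d - u)"
        using False d_pos by (intro mult_nonneg_nonneg) (auto simp: u_def)
      then have "0 \<le> (- 4 * (u - d / 2)\<^sup>2 + (d\<^sup>2 - u * d)) / (8 * \<sigma>\<^sup>2)"
        by (intro divide_nonneg_nonneg) (auto simp: power2_eq_square algebra_simps)
      then show ?thesis
        by (simp add: diff_divide_distrib add_divide_distrib)
    qed
    finally show ?thesis
      unfolding g_def exp_add .
  qed
  then have "m * (D i \<sigma> x)\<^sup>2 \<le> (m * g) * exp (d\<^sup>2 / (8 * \<sigma>\<^sup>2) - u * d / (8 * \<sigma>\<^sup>2))"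
    using assms(3) by simp
  also have "\<dots> \<le> (sqrt (2 * pi * \<sigma>\<^sup>2) * \<rho> \<sigma> x) * exp (d\<^sup>2 / (8 * \<sigma>\<^sup>2) - u * d / (8 * \<sigma>\<^sup>2))"
    by (intro mult_right_mono rho) simp
  finally show ?thesis
    by (simp add: u_def)
qed

text \<open>The diagonal bounds at \<open>i\<close> and \<open>j\<close> combine by taking the geometric mean.\<close>
lemma D_mult_le:
  assumes i: "i \<in> {1..N - 1}" and j: "j \<in> {1..N - 1}" and "\<sigma> > 0"
    and m: "m > 0" "\<And>k. k \<in> {1..N} \<Longrightarrow> m \<le> p k"
  shows "m * \<bar>D i \<sigma> x * D j \<sigma> x\<bar> \<le>
    sqrt (2 * pi * \<sigma>\<^sup>2) * exp (d\<^sup>2 / (8 * \<sigma>\<^sup>2)) * \<rho> \<sigma> x * exp (- \<bar>x - mid i\<bar> * d / (16 * \<sigma>\<^sup>2))"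
    (is "?l \<le> ?r")
proof -
  define R where "R = sqrt (2 * pi * \<sigma>\<^sup>2) * \<rho> \<sigma> x"
  define K where "K = d\<^sup>2 / (8 * \<sigma>\<^sup>2)"
  define T where "T = \<bar>x - mid i\<bar> * d / (16 * \<sigma>\<^sup>2)"
  have R: "R \<ge> 0"
    unfolding R_def using density_pos[OF index_range(1)[OF i] assms(3), of x] by simp
  have 1: "m * (D i \<sigma> x)\<^sup>2 \<le> R * exp (K - 2 * T)"
    using D_square_le[OF i assms(3) m(1) m(2) m(2), OF index_range(2,3)[OF i], of x]
    by (simp add: R_def K_def T_def mult.commute)
  have "m * (D j \<sigma> x)\<^sup>2 \<le> R * exp (d\<^sup>2 / (8 * \<sigma>\<^sup>2) - \<bar>x - mid j\<bar> * d / (8 * \<sigma>\<^sup>2))"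
    using D_square_le[OF j assms(3) m(1) m(2) m(2), OF index_range(2,3)[OF j], of x]
    by (simp add: R_def)
  \<comment> \<open>The decay around \<open>mid j\<close> is given up; the square root then halves
    the rate around \<open>mid i\<close> from 1/8 to 1/16.\<close>
  also have "\<dots> \<le> R * exp K"
    using R d_pos by (intro mult_left_mono) (auto simp: K_def)
  finally have 2: "m * (D j \<sigma> x)\<^sup>2 \<le> R * exp K" .
  have "?l\<^sup>2 = (m * (D i \<sigma> x)\<^sup>2) * (m * (D j \<sigma> x)\<^sup>2)"
    by (simp add: power_mult_distrib power2_eq_square)
  also have "\<dots> \<le> (R * exp (K - 2 * T)) * (R * exp K)"
    using m(1) R by (intro mult_mono 1 2) auto
  also have "\<dots> = R\<^sup>2 * exp (2 * K - 2 * T)"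
    by (simp add: power2_eq_square exp_add[symmetric] mult_ac)
  also have "\<dots> = (R * exp (K - T))\<^sup>2"
    by (simp add: power_mult_distrib exp_double[symmetric] right_diff_distrib)
  finally have "?l \<le> R * exp (K - T)"
    by (rule power2_le_imp_le) (use R in auto)
  also have "\<dots> = ?r"
    unfolding diff_conv_add_uminus exp_add by (simp add: R_def K_def T_def)
  finally show ?thesis .
qed

section \<open>Passing to the limit in a matrix entry\<close>

lemma information_entry_tendsto:
  assumes i: "i \<in> {1..N - 1}" and j: "j \<in> {1..N - 1}"
  shows "((\<lambda>\<sigma>. gmm_wim N \<mu> \<theta> \<sigma> $$ (i - 1, j - 1) / scaling_factor d \<sigma>) \<longlongrightarrow>
    (if i = j then 1 else 0) / sqrt (p i * p (i + 1))) (at_right 0)"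
proof -
  define S where "S \<sigma> = sqrt (2 * pi * \<sigma>\<^sup>2) * exp (d\<^sup>2 / (8 * \<sigma>\<^sup>2))" for \<sigma>
  \<comment> \<open>The integrand after the substitution, divided by \<open>S \<sigma>\<close>; the
    Jacobian and the factor \<open>pi\<close> are restored at the end.\<close>
  define H where "H \<sigma> t = D i \<sigma> (mid i + \<sigma>\<^sup>2 / d * t) * D j \<sigma> (mid i + \<sigma>\<^sup>2 / d * t) /
    (S \<sigma> * \<rho> \<sigma> (mid i + \<sigma>\<^sup>2 / d * t))" for \<sigma> t
  define \<delta> :: real where "\<delta> = (if i = j then 1 else 0)"
  define f where "f t = 1 / (p i * exp (- t / 2) + p (i + 1) * exp (t / 2))" for t
  define m where "m = Min (p ` {1..N})"
  \<comment> \<open>Equal to \<open>2 / m / (exp (- t / 16) + exp (t / 16))\<close>, spelled out as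
    an affine rescaling of the integrand of \<open>integral_inverse_exp_sum\<close> with both
    coefficients 1.\<close>
  define w where "w t = 2 / m * (1 / (1 * exp (- (0 + 1 / 8 * t) / 2) + 1 * exp ((0 + 1 / 8 * t) / 2)))" for t
  have N: "N \<ge> 1"
    by (rule index_range(1)[OF i])
  have pos: "p i > 0" "p (i + 1) > 0"
    by (intro weight_pos index_range i)+
  have m: "m > 0" "\<And>k. k \<in> {1..N} \<Longrightarrow> m \<le> p k"
    using N weight_pos by (auto simp: m_def)
  have S: "S \<sigma> > 0" if "\<sigma> > 0" for \<sigma>
    using that by (simp add: S_def)
  have fm [measurable]: "f \<in> borel_measurable borel"
    unfolding f_def by measurable
  have Hm [measurable]: "H \<sigma> \<in> borel_measurable borel" for \<sigma>
    unfolding H_def D_def gmm_density_def by measurable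
  have w: "integrable lborel w"
    unfolding w_def
    by (intro integrable_mult_right
        lborel_integrable_real_affine[OF integral_inverse_exp_sum(1)[of 1 1]]) auto
  have lim: "((\<lambda>\<sigma>. H \<sigma> t) \<longlongrightarrow> \<delta> * f t) (at_right 0)" for t
  proof -
    have "p i * exp (- t / 2) + p (i + 1) * exp (t / 2) > 0"
      using pos by (intro add_pos_pos) auto
    \<comment> \<open>The first conditional is the diagonal instance of \<open>D_tendsto\<close>;
      for \<open>i = j\<close> the two signs cancel.\<close>
    then have "((\<lambda>\<sigma>. H \<sigma> t) \<longlongrightarrow> (if i = i then - 1 else 0) * (if i = j then - 1 else 0) /
        (p i * exp (- t / 2) + p (i + 1) * exp (t / 2))) (at_right 0)"
      unfolding H_def S_def by (intro tendsto_divide tendsto_mult[OF D_tendsto D_tendsto] density_tendsto i j) auto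
    then show ?thesis
      by (cases "i = j") (simp_all add: \<delta>_def f_def)
  qed
  have bound: "\<bar>H \<sigma> t\<bar> \<le> w t" if \<sigma>: "\<sigma> > 0" for \<sigma> t
  proof -
    let ?x = "mid i + \<sigma>\<^sup>2 / d * t"
    have den: "S \<sigma> * \<rho> \<sigma> ?x > 0"
      using S \<sigma> density_pos[OF N] by simp
    have "- \<bar>?x - mid i\<bar> * d / (16 * \<sigma>\<^sup>2) = - \<bar>t / 16\<bar>"
      using d_pos \<sigma> by (simp add: abs_mult)
    with D_mult_le[OF i j \<sigma> m, of ?x] have "m * \<bar>D i \<sigma> ?x * D j \<sigma> ?x\<bar> \<le> S \<sigma> * \<rho> \<sigma> ?x * exp (- \<bar>t / 16\<bar>)"
      unfolding S_def by (simp only:)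
    then have "\<bar>H \<sigma> t\<bar> \<le> exp (- \<bar>t / 16\<bar>) / m"
      using den m(1) unfolding H_def abs_divide by (simp add: field_simps)
    also have "\<dots> \<le> (2 / (exp (- (t / 16)) + exp (t / 16))) / m"
      using m(1) by (intro divide_right_mono exp_neg_abs_le_inverse_exp_sum) auto
    also have "\<dots> = w t"
      by (simp add: w_def)
    finally show ?thesis .
  qed
  have "((\<lambda>\<sigma>. LBINT t. H \<sigma> t) \<longlongrightarrow> (LBINT t. \<delta> * f t)) (at_right 0)"
    \<comment> \<open>Dominated convergence is used with a parameter \<open>s\<close> tending to
      infinity, hence \<sigma> becomes \<open>inverse s\<close>.\<close>
    unfolding filterlim_at_right_to_top
  proof (rule integral_dominated_convergence_at_top[where w = w])
    show "\<forall>\<^sub>F s in at_top. AE t in lborel. norm (H (inverse s) t) \<le> w t"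
      using eventually_gt_at_top[of 0] by eventually_elim (use bound in auto)
    show "AE t in lborel. ((\<lambda>s. H (inverse s) t) \<longlongrightarrow> \<delta> * f t) at_top"
      using lim unfolding filterlim_at_right_to_top by simp
  qed (use w in simp_all)
  also have "(LBINT t. \<delta> * f t) = \<delta> * (pi / sqrt (p i * p (i + 1)))"
    unfolding f_def integral_mult_right_zero integral_inverse_exp_sum(2)[OF pos] ..
  finally have "((\<lambda>\<sigma>. (LBINT t. H \<sigma> t) / pi) \<longlongrightarrow> \<delta> * (pi / sqrt (p i * p (i + 1))) / pi) (at_right 0)"
    by (intro tendsto_divide tendsto_const) auto
  moreover have "\<forall>\<^sub>F \<sigma> in at_right 0. (LBINT t. H \<sigma> t) / pi =
      gmm_wim N \<mu> \<theta> \<sigma> $$ (i - 1, j - 1) / scaling_factor d \<sigma>"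
    using eventually_at_right_less[of 0]
  proof eventually_elim
    case (elim \<sigma>)
    \<comment> \<open>\<open>sqrt (2 * pi ^ 3)\<close> supplies the factor \<open>pi\<close>, and
      one of the three powers of \<sigma> goes into the square root in
      \<open>S \<sigma>\<close>.\<close>
    have K: "scaling_factor d \<sigma> = pi * (\<sigma>\<^sup>2 / d) * S \<sigma>"
      using elim by (simp add: scaling_factor_def S_def real_sqrt_mult power3_eq_cube power2_eq_square)
    have "gmm_wim N \<mu> \<theta> \<sigma> $$ (i - 1, j - 1) = (LBINT x. D i \<sigma> x * D j \<sigma> x / \<rho> \<sigma> x)"
      using gmm_wim_entry[OF elim i j] unfolding D_def gauss_cdf_def .
    also have "\<dots> = \<bar>\<sigma>\<^sup>2 / d\<bar> *\<^sub>R (LBINT t. S \<sigma> * H \<sigma> t)"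
      using elim d_pos S[OF elim]
      by (subst lborel_integral_real_affine[of "\<sigma>\<^sup>2 / d" _ "mid i"]) (simp_all add: H_def)
    finally show ?case
      unfolding K using elim d_pos S[OF elim] by simp
  qed
  ultimately show ?thesis
    unfolding \<delta>_def[symmetric] by (auto intro: Lim_transform_eventually)
qed

end

theorem theorem3:
  fixes N :: nat and d :: real and \<mu> \<theta> :: "nat \<Rightarrow> real"
  assumes "N \<ge> 2" and "d > 0"
    and "\<And>i. i \<in> {2..N} \<Longrightarrow> \<mu> i - \<mu> (i - 1) = d"
    and "\<theta> 0 = 1" and "\<theta> N = 0"
    and "\<And>i. i \<in> {1..N} \<Longrightarrow> \<theta> (i - 1) > \<theta> i"
  shows "(\<forall>i\<in>{1..N - 1}. \<forall>j\<in>{1..N - 1}.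
            ((\<lambda>\<sigma>. gmm_wim N \<mu> \<theta> \<sigma> $$ (i - 1, j - 1) / scaling_factor d \<sigma>) \<longlongrightarrow>
               (if i = j then 1 else 0) / sqrt (gmm_weight \<theta> i * gmm_weight \<theta> (i + 1)))
              (at_right 0)) \<and>
         mat_tendsto (\<lambda>\<sigma>. (1 / scaling_factor d \<sigma>) \<cdot>\<^sub>m gmm_wim N \<mu> \<theta> \<sigma>)
           (mat_diag (N - 1) (\<lambda>i. 1 / sqrt (gmm_weight \<theta> (i + 1) * gmm_weight \<theta> (i + 2))))
           (at_right 0)"
proof -
  interpret gaussian_mixture N d \<mu> \<theta>
    by (rule gaussian_mixture.intro; fact assms)
  have dim: "gmm_wim N \<mu> \<theta> \<sigma> \<in> carrier_mat (N - 1) (N - 1)" for \<sigma>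
    by (simp add: gmm_wim_def wasserstein_information_matrix_def)
  have "((\<lambda>\<sigma>. ((1 / scaling_factor d \<sigma>) \<cdot>\<^sub>m gmm_wim N \<mu> \<theta> \<sigma>) $$ (a, b)) \<longlongrightarrow>
      mat_diag (N - 1) (\<lambda>i. 1 / sqrt (p (i + 1) * p (i + 2))) $$ (a, b)) (at_right 0)"
    if "a < N - 1" "b < N - 1" for a b
  proof -
    \<comment> \<open>Matrix positions start at 0 and parameters at 1; \<open>a + 1 - 1\<close>
      brings the entry into the form of \<open>information_entry_tendsto\<close>.\<close>
    have "((1 / scaling_factor d \<sigma>) \<cdot>\<^sub>m gmm_wim N \<mu> \<theta> \<sigma>) $$ (a, b) =
        gmm_wim N \<mu> \<theta> \<sigma> $$ (a + 1 - 1, b + 1 - 1) / scaling_factor d \<sigma>" for \<sigma>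
      using dim[of \<sigma>] that by auto
    moreover have "mat_diag (N - 1) (\<lambda>i. 1 / sqrt (p (i + 1) * p (i + 2))) $$ (a, b) =
        (if a + 1 = b + 1 then 1 else 0) / sqrt (p (a + 1) * p (a + 1 + 1))"
      using that by (auto simp: mat_diag_def)
    moreover have "a + 1 \<in> {1..N - 1}" "b + 1 \<in> {1..N - 1}"
      using that by auto
    moreover note information_entry_tendsto[OF this]
    ultimately show ?thesis
      by (simp only:)
  qed
  moreover have "mat_diag (N - 1) f \<in> carrier_mat (N - 1) (N - 1)" for f :: "nat \<Rightarrow> real"
    by (simp add: mat_diag_def)
  ultimately have "mat_tendsto (\<lambda>\<sigma>. (1 / scaling_factor d \<sigma>) \<cdot>\<^sub>m gmm_wim N \<mu> \<theta> \<sigma>)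
      (mat_diag (N - 1) (\<lambda>i. 1 / sqrt (p (i + 1) * p (i + 2)))) (at_right 0)"
    unfolding mat_tendsto_def carrier_matD[OF \<open>\<And>f. mat_diag (N - 1) f \<in> _\<close>]
    by (intro conjI allI impI always_eventually smult_carrier_mat dim)
  then show ?thesis
    by (intro conjI ballI information_entry_tendsto)
qed

end
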